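(* Let $\mathcal{H}$ be a complex Hilbert space and let $A,B\in L(\mathcal{H})$. Then $R(B)=R(A)\dotplus R(B-A)$ (that is, $A$ is below $B$ in the left minus order) if and only if there exists a (possibly unbounded) densely defined projection $P$ on $\mathcal{H}$ such that $A=PB$ and $R(A)\subseteq R(B)$.
   Context: $L(\mathcal{H})$ is the algebra of bounded linear operators on $\mathcal{H}$, $R(T)$ is the range of $T$, and $\dotplus$ denotes a direct (algebraic) sum of linear subspaces (trivial intersection). A densely defined projection is a linear operator $P:\mathcal{D}(P)\to\mathcal{H}$ on a dense linear subspace $\mathcal{D}(P)\subseteq\mathcal{H}$ with $R(P)\subseteq\mathcal{D}(P)$ and $P^2=P$ (no boundedness or closedness is required). The equality $A=PB$ includes the requirement $R(B)\subseteq\mathcal{D}(P)$. *)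

theory Defs
  imports "HOL-Analysis.Analysis"
begin

text \<open>
  Complex Hilbert spaces extend the real normed spaces of the library, so that
  the metric and topological notions (completeness, closure) are those of HOL-Analysis.
  The inner product is linear in its first argument.
\<close>

class complex_vector = real_vector +
  fixes scaleC :: "complex \<Rightarrow> 'a \<Rightarrow> 'a"  (infixr \<open>*\<^sub>C\<close> 75)
  assumes scaleC_add_right: "a *\<^sub>C (x + y) = a *\<^sub>C x + a *\<^sub>C y"
    and scaleC_add_left: "(a + b) *\<^sub>C x = a *\<^sub>C x + b *\<^sub>C x"
    and scaleC_scaleC: "a *\<^sub>C b *\<^sub>C x = (a * b) *\<^sub>C x"
    and scaleC_one: "1 *\<^sub>C x = x"
    and scaleR_scaleC: "r *\<^sub>R x = complex_of_real r *\<^sub>C x"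

global_interpretation complex_vector:
  vector_space "scaleC :: complex \<Rightarrow> 'a \<Rightarrow> 'a::complex_vector"
  by unfold_locales (fact scaleC_add_right scaleC_add_left scaleC_scaleC scaleC_one)+

text \<open>
  Positive definiteness of the inner product is contained in \<open>cinner_self\<close>,
  since \<^term>\<open>norm\<close> is already a norm.
\<close>

class complex_inner = complex_vector + real_normed_vector +
  fixes cinner :: "'a \<Rightarrow> 'a \<Rightarrow> complex"
  assumes cinner_commute: "cinner x y = cnj (cinner y x)"
    and cinner_add_left: "cinner (x + y) z = cinner x z + cinner y z"
    and cinner_scaleC_left: "cinner (a *\<^sub>C x) y = a * cinner x y"
    and cinner_self: "cinner x x = complex_of_real ((norm x)\<^sup>2)"

class complex_hilbert_space = complex_inner + complete_space
begin

subclass banach ..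

end

instantiation complex :: complex_hilbert_space
begin

definition scaleC_complex :: "complex \<Rightarrow> complex \<Rightarrow> complex"
  where "scaleC_complex a x = a * x"

definition cinner_complex :: "complex \<Rightarrow> complex \<Rightarrow> complex"
  where "cinner_complex x y = x * cnj y"

instance
  by standard
    (simp_all add: scaleC_complex_def cinner_complex_def algebra_simps scaleR_conv_of_real
      complex_norm_square [symmetric])

end

abbreviation csubspace :: "'a::complex_vector set \<Rightarrow> bool"
  where "csubspace \<equiv> module.subspace scaleC"

abbreviation clinear :: "('a::complex_vector \<Rightarrow> 'b::complex_vector) \<Rightarrow> bool"
  where "clinear \<equiv> Vector_Spaces.linear scaleC scaleC"

definition bounded_clinear :: "('a::complex_inner \<Rightarrow> 'b::complex_inner) \<Rightarrow> bool"
  where "bounded_clinear T \<longleftrightarrow> clinear T \<and> (\<exists>K. \<forall>x. norm (T x) \<le> K * norm x)"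

definition is_direct_sum :: "'a::complex_vector set \<Rightarrow> 'a set \<Rightarrow> 'a set \<Rightarrow> bool"
  where "is_direct_sum S M N \<longleftrightarrow> S = {x + y | x y. x \<in> M \<and> y \<in> N} \<and> M \<inter> N = {0}"

text \<open>
  A partially defined operator is given by its domain \<open>D\<close> and a function \<open>P\<close> of which
  only the values on \<open>D\<close> are relevant.
\<close>

definition clinear_on :: "'a::complex_vector set \<Rightarrow> ('a \<Rightarrow> 'b::complex_vector) \<Rightarrow> bool"
  where "clinear_on D P \<longleftrightarrow> csubspace D
    \<and> (\<forall>x\<in>D. \<forall>y\<in>D. P (x + y) = P x + P y)
    \<and> (\<forall>c. \<forall>x\<in>D. P (c *\<^sub>C x) = c *\<^sub>C P x)"

definition densely_defined_projection :: "'a::complex_inner set \<Rightarrow> ('a \<Rightarrow> 'a) \<Rightarrow> bool"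
  where "densely_defined_projection D P \<longleftrightarrow>
    clinear_on D P \<and> closure D = UNIV \<and> P ` D \<subseteq> D \<and> (\<forall>x\<in>D. P (P x) = P x)"

text \<open>
  The equality \<open>A = PB\<close> of operators includes equality of domains: as \<open>A\<close> is everywhere
  defined, \<open>B\<close> must map into the domain \<open>D\<close> of \<open>P\<close>.
\<close>

definition eq_comp_on :: "('a \<Rightarrow> 'c) \<Rightarrow> 'b set \<Rightarrow> ('b \<Rightarrow> 'c) \<Rightarrow> ('a \<Rightarrow> 'b) \<Rightarrow> bool"
  where "eq_comp_on A D P B \<longleftrightarrow> range B \<subseteq> D \<and> (\<forall>x. A x = P (B x))"

end

theory Submission
  imports Defs
begin

text \<open>
  For the forward direction let \<open>G\<close> be a linear map with \<open>B (G y) = y\<close> for all \<open>y\<close> in the range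
  of \<open>B\<close>; such a map exists by a Hamel basis argument, without any continuity. Directness of the sum
  forces \<open>A u = A z\<close> whenever \<open>A u = B z\<close>, and also that the kernel of \<open>B\<close> is contained in that
  of \<open>A\<close>. Hence \<open>P = A \<circ> G\<close> is a projection defined on the whole space with \<open>A = P B\<close>.
  Conversely, \<open>P\<close> fixes the range of \<open>A\<close> and annihilates that of \<open>B - A\<close>.
\<close>

global_interpretation complex_vector_pair:
  vector_space_pair "scaleC :: complex \<Rightarrow> 'a \<Rightarrow> 'a::complex_vector"
    "scaleC :: complex \<Rightarrow> 'b \<Rightarrow> 'b::complex_vector"
  by unfold_locales

text \<open>Additivity of \<open>P\<close> applied to \<open>x = (x - y) + y\<close>, where the
  subspace \<open>D\<close> also contains \<open>x - y\<close>.\<close>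

lemma clinear_on_diff:
  assumes P: "clinear_on D P" and x: "x \<in> D" and y: "y \<in> D"
  shows "P (x - y) = P x - P y"
proof -
  have D: "csubspace D" using P by (simp add: clinear_on_def)
  have "x - y \<in> D" using D x y by (rule complex_vector.subspace_diff)
  then have "P (x - y + y) = P (x - y) + P y" using P y unfolding clinear_on_def by blast
  then show ?thesis by simp
qed

lemma clinear_imp_clinear_on_UNIV:
  assumes "clinear P"
  shows "clinear_on UNIV P"
proof -
  interpret P: Vector_Spaces.linear scaleC scaleC P by fact
  show ?thesis by (simp add: clinear_on_def P.add P.scale)
qed

text \<open>The trivial intersection already places \<open>0\<close> in \<open>N\<close>, so each
  \<open>y\<close> in \<open>M\<close> is the sum \<open>y + 0\<close>.\<close>

lemma is_direct_sum_left_subset: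
  assumes "is_direct_sum S M N"
  shows "M \<subseteq> S"
proof
  fix y assume "y \<in> M"
  moreover have "0 \<in> N" using assms by (auto simp: is_direct_sum_def)
  ultimately have "y + 0 \<in> S" using assms unfolding is_direct_sum_def by blast
  then show "y \<in> S" by simp
qed

lemma projection_of_direct_sum:
  fixes A B :: "'a::complex_inner \<Rightarrow> 'a"
  assumes A: "clinear A" and B: "clinear B"
    and sum: "is_direct_sum (range B) (range A) (range (\<lambda>x. B x - A x))"
  shows "\<exists>P. densely_defined_projection UNIV P \<and> eq_comp_on A UNIV P B"
proof -
  interpret A: Vector_Spaces.linear scaleC scaleC A by fact
  interpret B: Vector_Spaces.linear scaleC scaleC B by fact
  have int: "range A \<inter> range (\<lambda>x. B x - A x) = {0}"
    using sum by (simp add: is_direct_sum_def)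
  have eq: "A u = A z" if "A u = B z" for u z
  proof -
    \<comment> \<open>The two sides exhibit one vector as an element of both summands, so directness
      makes it zero.\<close>
    have "A (u - z) = B z - A z" by (simp add: A.diff that)
    then have "A (u - z) \<in> range (\<lambda>x. B x - A x)" by (rule range_eqI)
    with int have "A (u - z) = 0" by blast
    then show ?thesis by (simp add: A.diff)
  qed
  obtain G where G: "clinear G" and BG: "\<And>y. y \<in> range B \<Longrightarrow> B (G y) = y"
    using complex_vector_pair.linear_exists_right_inverse_on[OF B complex_vector.subspace_UNIV]
    by blast
  have AGB: "A (G (B x)) = A x" for x
  proof -
    \<comment> \<open>\<open>G (B x) - x\<close> lies in the kernel of \<open>B\<close>; the case
      \<open>u = 0\<close> of \<open>eq\<close> moves it into the kernel of
      \<open>A\<close>.\<close>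
    have "A 0 = B (G (B x) - x)" by (simp add: B.diff BG A.zero)
    then have "A 0 = A (G (B x) - x)" by (rule eq)
    then show ?thesis by (simp add: A.diff A.zero)
  qed
  have sub: "range A \<subseteq> range B" using sum by (rule is_direct_sum_left_subset)
  \<comment> \<open>With \<open>u = G x\<close> this is idempotence of \<open>A \<circ> G\<close>.
    Writing \<open>A u = B z\<close>, the left side is \<open>A z\<close> by \<open>AGB\<close>,
    which equals \<open>A u\<close> by \<open>eq\<close>.\<close>
  have "A (G (A u)) = A u" for u
  proof -
    obtain z where "A u = B z" using sub by blast
    then show ?thesis using eq AGB by metis
  qed
  moreover have "clinear (A \<circ> G)"
    using G A by (rule Vector_Spaces.linear_compose)
  ultimately have "densely_defined_projection UNIV (A \<circ> G)"
    by (simp add: densely_defined_projection_def clinear_imp_clinear_on_UNIV)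
  moreover have "eq_comp_on A UNIV (A \<circ> G) B"
    by (simp add: eq_comp_on_def AGB)
  ultimately show ?thesis by blast
qed

lemma direct_sum_of_projection:
  fixes A B :: "'a::complex_inner \<Rightarrow> 'a"
  assumes A: "clinear A" and B: "clinear B"
    and P: "densely_defined_projection D P" and comp: "eq_comp_on A D P B"
    and sub: "range A \<subseteq> range B"
  shows "is_direct_sum (range B) (range A) (range (\<lambda>x. B x - A x))"
  unfolding is_direct_sum_def
proof
  interpret A: Vector_Spaces.linear scaleC scaleC A by fact
  interpret B: Vector_Spaces.linear scaleC scaleC B by fact
  show "range B = {x + y |x y. x \<in> range A \<and> y \<in> range (\<lambda>x. B x - A x)}"
  proof (intro equalityI subsetI)
    fix v assume "v \<in> range B"
    then obtain x where "v = A x + (B x - A x)" by auto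
    then show "v \<in> {x + y |x y. x \<in> range A \<and> y \<in> range (\<lambda>x. B x - A x)}" by blast
  next
    fix v assume "v \<in> {x + y |x y. x \<in> range A \<and> y \<in> range (\<lambda>x. B x - A x)}"
    then obtain u x where v: "v = A u + (B x - A x)" by blast
    \<comment> \<open>The range inclusion turns both values of \<open>A\<close> into values of
      \<open>B\<close>, so \<open>v\<close> becomes a combination of values of
      \<open>B\<close>.\<close>
    obtain u' x' where u': "A u = B u'" and x': "A x = B x'" using sub by blast
    then have "v = B (u' + (x - x'))" by (simp add: v u' x' B.add B.diff)
    then show "v \<in> range B" by blast
  qed
  have PB: "P (B x) = A x" and BD: "B x \<in> D" for x
    using comp unfolding eq_comp_on_def by (simp, blast)
  have lin: "clinear_on D P" and PP: "\<And>x. x \<in> D \<Longrightarrow> P (P x) = P x"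
    using P by (simp_all add: densely_defined_projection_def)
  have PA: "P (A x) = A x" for x using PP[OF BD[of x]] by (simp add: PB)
  have AD: "A x \<in> D" for x using sub comp unfolding eq_comp_on_def by blast
  have "y = 0" if y: "y \<in> range A" "y \<in> range (\<lambda>x. B x - A x)" for y
  proof -
    obtain u v where u: "y = A u" and v: "y = B v - A v" using y by blast
    \<comment> \<open>As a value of \<open>A\<close>, \<open>y\<close> is fixed by \<open>P\<close>;
      as \<open>B v - A v\<close> it is sent to zero, because \<open>P (B v)\<close> and
      \<open>P (A v)\<close> both equal \<open>A v\<close>.\<close>
    have "P y = y" unfolding u by (rule PA)
    moreover have "P y = 0" unfolding v by (simp add: clinear_on_diff[OF lin BD AD] PA PB)
    ultimately show ?thesis by simp
  qed
  moreover have "0 \<in> range A" "0 \<in> range (\<lambda>x. B x - A x)"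
    by (rule range_eqI[where x = 0], simp add: A.zero B.zero)+
  ultimately show "range A \<inter> range (\<lambda>x. B x - A x) = {0}" by blast
qed

theorem proposition3p13:
  fixes A B :: "'h::complex_hilbert_space \<Rightarrow> 'h"
  assumes "bounded_clinear A" and "bounded_clinear B"
  shows "is_direct_sum (range B) (range A) (range (\<lambda>x. B x - A x)) \<longleftrightarrow>
    (\<exists>D P. densely_defined_projection D P \<and> eq_comp_on A D P B \<and> range A \<subseteq> range B)"
proof -
  have lin: "clinear A" "clinear B" using assms by (simp_all add: bounded_clinear_def)
  show ?thesis
  proof
    assume sum: "is_direct_sum (range B) (range A) (range (\<lambda>x. B x - A x))"
    show "\<exists>D P. densely_defined_projection D P \<and> eq_comp_on A D P B \<and> range A \<subseteq> range B"
      using projection_of_direct_sum[OF lin sum] is_direct_sum_left_subset[OF sum] by blast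
  next
    assume "\<exists>D P. densely_defined_projection D P \<and> eq_comp_on A D P B \<and> range A \<subseteq> range B"
    then show "is_direct_sum (range B) (range A) (range (\<lambda>x. B x - A x))"
      using direct_sum_of_projection[OF lin] by blast
  qed
qed

end
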